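(* Let $r_1,r_2\in\mathbb{C}$, let $s_1,s_2\in\mathbb{C}\setminus\{0\}$, and let $t_1,t_2\in\mathbb{C}$ be either both non-zero or both zero. Let $B=B(r_1,r_2;s_1,s_2;t_1,t_2)$ be the associated operator on $l_1$. Then the point spectrum of $B$ on $l_1$ is empty: $\sigma_p(B,l_1)=\emptyset$.
   Context: Sequences are indexed by $\mathbb{N}=\{1,2,3,\dots\}$, and $l_1$ is the complex Banach space of absolutely summable sequences. The operator $B=B(r_1,r_2;s_1,s_2;t_1,t_2)$ is given by the infinite lower triangular triple band matrix with period-two bands: with the convention $x_{-1}=x_0=0$, $(Bx)_n=t_1x_{n-2}+s_2x_{n-1}+r_1x_n$ for $n$ odd and $(Bx)_n=t_2x_{n-2}+s_1x_{n-1}+r_2x_n$ for $n$ even. The point spectrum $\sigma_p(T,X)$ of a bounded operator $T$ on $X$ is the set of $\lambda\in\mathbb{C}$ with $N(T-\lambda I)\ne\{0\}$, where $N$ denotes the null space. *)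

theory Defs
  imports Complex_Main
begin

text \<open>
  A sequence $(x_n)_{n \ge 1}$ is a function \<open>x :: nat \<Rightarrow> complex\<close> with the extra entry \<open>x 0\<close>
  fixed to \<open>0\<close>, so that sequences and such functions correspond one to one.
\<close>

definition l1 :: "(nat \<Rightarrow> complex) set" where
  "l1 = {x. x 0 = 0 \<and> summable (\<lambda>n. norm (x n))}"

definition l1_norm :: "(nat \<Rightarrow> complex) \<Rightarrow> real" where
  "l1_norm x = (\<Sum>n. norm (x n))"

text \<open>
  The conditionals implement $x_{-1} = x_0 = 0$; the value at \<open>n = 0\<close> is the padding entry.
\<close>

definition triple_band ::
  "complex \<Rightarrow> complex \<Rightarrow> complex \<Rightarrow> complex \<Rightarrow> complex \<Rightarrow> complex
    \<Rightarrow> (nat \<Rightarrow> complex) \<Rightarrow> nat \<Rightarrow> complex" where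
  "triple_band r1 r2 s1 s2 t1 t2 x n =
    (let y = (\<lambda>k. if k < n then x (n - k) else 0) in
     if n = 0 then 0
     else if odd n then t1 * y 2 + s2 * y 1 + r1 * y 0
     else t2 * y 2 + s1 * y 1 + r2 * y 0)"

definition null_space ::
  "(nat \<Rightarrow> complex) set \<Rightarrow> ((nat \<Rightarrow> complex) \<Rightarrow> nat \<Rightarrow> complex) \<Rightarrow> (nat \<Rightarrow> complex) set" where
  "null_space X T = {x \<in> X. T x = (\<lambda>n. 0)}"

definition point_spectrum ::
  "((nat \<Rightarrow> complex) \<Rightarrow> nat \<Rightarrow> complex) \<Rightarrow> (nat \<Rightarrow> complex) set \<Rightarrow> complex set" where
  "point_spectrum T X = {\<mu>. null_space X (\<lambda>x n. T x n - \<mu> * x n) \<noteq> {\<lambda>n. 0}}"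

text \<open>The triple band operator is a bounded linear operator from \<open>l1\<close> to itself.\<close>

lemma triple_band_linear:
  "triple_band r1 r2 s1 s2 t1 t2 (\<lambda>n. a * x n + b * y n) =
    (\<lambda>n. a * triple_band r1 r2 s1 s2 t1 t2 x n + b * triple_band r1 r2 s1 s2 t1 t2 y n)"
  by (rule ext) (simp add: triple_band_def Let_def algebra_simps)

lemma triple_band_bounded:
  fixes r1 r2 s1 s2 t1 t2 :: complex
  defines "C \<equiv> norm r1 + norm r2 + norm s1 + norm s2 + norm t1 + norm t2"
  assumes x: "x \<in> l1"
  shows "triple_band r1 r2 s1 s2 t1 t2 x \<in> l1"
    and "l1_norm (triple_band r1 r2 s1 s2 t1 t2 x) \<le> 3 * C * l1_norm x"
proof -
  define f where "f k n = (if k \<le> n then norm (x (n - k)) else 0)" for k n :: nat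
  have sums: "f k sums l1_norm x" for k
  proof -
    have "(\<lambda>n. norm (x n)) sums l1_norm x"
      using x by (simp add: l1_def l1_norm_def summable_sums)
    moreover have "(\<lambda>n. f k (n + k)) = (\<lambda>n. norm (x n))"
      by (auto simp: f_def)
    moreover have "(\<Sum>i<k. f k i) = 0"
      by (simp add: f_def)
    ultimately show ?thesis
      using sums_iff_shift'[of "f k" k "l1_norm x"] by simp
  qed
  have C: "norm r1 \<le> C" "norm r2 \<le> C" "norm s1 \<le> C" "norm s2 \<le> C" "norm t1 \<le> C" "norm t2 \<le> C"
    by (simp_all add: C_def)
  have tri: "norm (t * u + s * v + r * w) \<le> C * (norm w + norm v + norm u)"
    if "norm t \<le> C" "norm s \<le> C" "norm r \<le> C" for t s r u v w :: complex
  proof -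
    have "norm (t * u + s * v + r * w) \<le> norm t * norm u + norm s * norm v + norm r * norm w"
      by (metis norm_mult norm_triangle_mono norm_triangle_ineq order_refl)
    also have "\<dots> \<le> C * norm u + C * norm v + C * norm w"
      using that by (intro add_mono mult_right_mono) auto
    finally show ?thesis by (simp add: algebra_simps)
  qed
  have bound: "norm (triple_band r1 r2 s1 s2 t1 t2 x n) \<le> C * (f 0 n + f 1 n + f 2 n)" for n
  proof -
    define y where "y k = (if k < n then x (n - k) else 0)" for k
    have y: "norm (y k) = f k n" for k
      using x by (auto simp: y_def f_def l1_def)
    have "0 \<le> C" by (simp add: C_def)
    hence n: "0 \<le> C * (f 0 n + f 1 n + f 2 n)" by (simp add: f_def)
    have "triple_band r1 r2 s1 s2 t1 t2 x n = (if n = 0 then 0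
      else if odd n then t1 * y 2 + s2 * y 1 + r1 * y 0
      else t2 * y 2 + s1 * y 1 + r2 * y 0)"
      unfolding triple_band_def Let_def y_def ..
    thus ?thesis
      using n tri[of t1 s2 r1 "y 2" "y 1" "y 0"] tri[of t2 s1 r2 "y 2" "y 1" "y 0"] C
      by (cases "n = 0") (simp_all add: y)
  qed
  have S: "(\<lambda>n. C * (f 0 n + f 1 n + f 2 n)) sums (C * (l1_norm x + l1_norm x + l1_norm x))"
    by (intro sums_mult sums_add sums)
  have sm: "summable (\<lambda>n. norm (triple_band r1 r2 s1 s2 t1 t2 x n))"
    by (rule summable_comparison_test'[OF sums_summable[OF S]]) (use bound in simp)
  thus "triple_band r1 r2 s1 s2 t1 t2 x \<in> l1"
    by (simp add: l1_def triple_band_def)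
  have "l1_norm (triple_band r1 r2 s1 s2 t1 t2 x) \<le> C * (l1_norm x + l1_norm x + l1_norm x)"
    unfolding l1_norm_def[of "triple_band r1 r2 s1 s2 t1 t2 x"] sums_unique[OF S]
    by (rule suminf_le[OF bound sm sums_summable[OF S]])
  thus "l1_norm (triple_band r1 r2 s1 s2 t1 t2 x) \<le> 3 * C * l1_norm x"
    by (simp add: algebra_simps)
qed

end

theory Submission
  imports Defs
begin

text \<open>
  An eigenvector is ruled out by finitely many rows of \<open>B x = \<mu> x\<close> next to its first
  non-zero entry \<open>x k\<close>. Row \<open>k\<close> reads \<open>d * x k = 0\<close>, so the diagonal entry \<open>d\<close> of
  \<open>B - \<mu> I\<close> vanishes there, and by periodicity it vanishes again in rows \<open>k + 2\<close> and
  \<open>k + 4\<close>. The five rows \<open>k, \<dots>, k + 4\<close> therefore involve only the four unknowns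
  \<open>x k, \<dots>, x (k + 3)\<close>, and eliminating from this overdetermined system gives \<open>x k = 0\<close>
  (lemma \<open>five_rows_eliminate\<close>). The two parities of \<open>k\<close> give the same system with the
  roles of the indices 1 and 2 exchanged.
\<close>

text \<open>
  Here \<open>d\<close> and \<open>e\<close> are the two diagonal entries and \<open>u, v, w, z, y\<close> are consecutive
  entries of the sequence. If \<open>u \<noteq> 0\<close>, then \<open>d = 0\<close>, and rows two and three say that the
  matrix with rows \<open>(s, e)\<close> and \<open>(t, s')\<close> kills \<open>(u, v)\<close>, hence is singular. So
  \<open>e * t = s * s' \<noteq> 0\<close>, which makes \<open>t\<close> and therefore \<open>t'\<close> non-zero. Rows four and five
  contain the same matrix, acting on \<open>(w, z)\<close>. The linear combination of its rows that
  vanishes leaves \<open>s' * t' * v = 0\<close>, whereas row two excludes \<open>v = 0\<close>.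
\<close>

lemma five_rows_eliminate:
  fixes d e s s' t t' u v w z y :: "'a::field"
  assumes s: "s \<noteq> 0" "s' \<noteq> 0" and t: "t = 0 \<or> t' \<noteq> 0"
    and row1: "d * u = 0"
    and row2: "s * u + e * v = 0"
    and row3: "t * u + s' * v + d * w = 0"
    and row4: "t' * v + s * w + e * z = 0"
    and row5: "t * w + s' * z + d * y = 0"
  shows "u = 0"
proof (rule ccontr)
  assume u: "u \<noteq> 0"
  hence d: "d = 0" using row1 by simp
  have v: "v \<noteq> 0" using row2 s u by auto
  have "(s * s' - e * t) * u = s' * (s * u + e * v) - e * (t * u + s' * v + d * w)"
    by (simp add: d algebra_simps)
  hence singular: "s * s' = e * t" using u row2 row3 by simp
  hence "t' \<noteq> 0" using s t by auto
  have "s' * t' * v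
      = s' * (t' * v + s * w + e * z) - e * (t * w + s' * z + d * y) - (s * s' - e * t) * w"
    by (simp add: d algebra_simps)
  also have "\<dots> = 0" by (simp only: row4 row5 singular) simp
  finally show False using s v \<open>t' \<noteq> 0\<close> by simp
qed

text \<open>
  On sequences with \<open>x 0 = 0\<close>, truncated subtraction on \<open>nat\<close> already encodes
  \<open>x (-1) = x 0 = 0\<close>.
\<close>

lemma triple_band_eq:
  assumes "x 0 = 0"
  shows "triple_band r1 r2 s1 s2 t1 t2 x n =
    (if odd n then t1 * x (n - 2) + s2 * x (n - 1) + r1 * x n
     else t2 * x (n - 2) + s1 * x (n - 1) + r2 * x n)"
proof -
  have "(if k < n then x (n - k) else 0) = x (n - k)" for k
    using assms by simp
  thus ?thesis using assms by (auto simp: triple_band_def Let_def)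
qed

lemma triple_band_eigenvector_zero:
  fixes r1 r2 s1 s2 t1 t2 \<mu> :: complex
  assumes s: "s1 \<noteq> 0" "s2 \<noteq> 0"
    and t: "(t1 \<noteq> 0 \<and> t2 \<noteq> 0) \<or> (t1 = 0 \<and> t2 = 0)"
    and x0: "x 0 = 0"
    and eigen: "\<And>n. triple_band r1 r2 s1 s2 t1 t2 x n - \<mu> * x n = 0"
  shows "x = (\<lambda>n. 0)"
proof (rule ccontr)
  assume "x \<noteq> (\<lambda>n. 0)"
  then obtain k where k: "x k \<noteq> 0" and first: "\<And>j. j < k \<Longrightarrow> x j = 0"
    using exists_least_iff[of "\<lambda>n. x n \<noteq> 0"] by (auto simp: fun_eq_iff)
  have "0 < k" using k x0 by (cases k) auto
  hence before: "x (k - 1) = 0" "x (k - 2) = 0" by (simp_all add: first)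
  have odd_row: "t1 * x (n - 2) + s2 * x (n - 1) + (r1 - \<mu>) * x n = 0" if "odd n" for n
    using eigen[of n] that by (simp add: triple_band_eq[of x, OF x0] algebra_simps)
  have even_row: "t2 * x (n - 2) + s1 * x (n - 1) + (r2 - \<mu>) * x n = 0" if "even n" for n
    using eigen[of n] that by (simp add: triple_band_eq[of x, OF x0] algebra_simps)
  have t': "t1 = 0 \<or> t2 \<noteq> 0" "t2 = 0 \<or> t1 \<noteq> 0" using t by auto
  have "x k = 0"
  proof (cases "odd k")
    case True
    show ?thesis
      by (rule five_rows_eliminate[where d = "r1 - \<mu>" and e = "r2 - \<mu>" and s = s1 and s' = s2
            and t = t1 and t' = t2 and v = "x (Suc k)" and w = "x (Suc (Suc k))"
            and z = "x (Suc (Suc (Suc k)))" and y = "x (Suc (Suc (Suc (Suc k))))"])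
        (use True s t' before odd_row[of k] even_row[of "Suc k"] odd_row[of "Suc (Suc k)"]
            even_row[of "Suc (Suc (Suc k))"] odd_row[of "Suc (Suc (Suc (Suc k)))"] in simp_all)
  next
    case False
    show ?thesis
      by (rule five_rows_eliminate[where d = "r2 - \<mu>" and e = "r1 - \<mu>" and s = s2 and s' = s1
            and t = t2 and t' = t1 and v = "x (Suc k)" and w = "x (Suc (Suc k))"
            and z = "x (Suc (Suc (Suc k)))" and y = "x (Suc (Suc (Suc (Suc k))))"])
        (use False s t' before even_row[of k] odd_row[of "Suc k"] even_row[of "Suc (Suc k)"]
            odd_row[of "Suc (Suc (Suc k))"] even_row[of "Suc (Suc (Suc (Suc k)))"] in simp_all)
  qed
  with k show False by contradiction
qed

theorem theorem4p3:
  fixes r1 r2 s1 s2 t1 t2 :: complex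
  assumes "s1 \<noteq> 0" and "s2 \<noteq> 0"
    and "(t1 \<noteq> 0 \<and> t2 \<noteq> 0) \<or> (t1 = 0 \<and> t2 = 0)"
  shows "point_spectrum (triple_band r1 r2 s1 s2 t1 t2) l1 = {}"
proof -
  have "null_space l1 (\<lambda>x n. triple_band r1 r2 s1 s2 t1 t2 x n - \<mu> * x n) = {\<lambda>n. 0}" for \<mu>
  proof
    show "null_space l1 (\<lambda>x n. triple_band r1 r2 s1 s2 t1 t2 x n - \<mu> * x n) \<subseteq> {\<lambda>n. 0}"
    proof
      fix x
      assume x: "x \<in> null_space l1 (\<lambda>x n. triple_band r1 r2 s1 s2 t1 t2 x n - \<mu> * x n)"
      have "x = (\<lambda>n. 0)"
        by (rule triple_band_eigenvector_zero[OF assms, where \<mu> = \<mu>])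
          (use x in \<open>auto simp: null_space_def l1_def dest: fun_cong\<close>)
      thus "x \<in> {\<lambda>n. 0}" by simp
    qed
    show "{\<lambda>n. 0} \<subseteq> null_space l1 (\<lambda>x n. triple_band r1 r2 s1 s2 t1 t2 x n - \<mu> * x n)"
      by (simp add: null_space_def l1_def triple_band_eq fun_eq_iff)
  qed
  thus ?thesis by (simp add: point_spectrum_def)
qed

end
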